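(* For every constant $a \ge 1$ there is a constant $C_a$ such that the following holds. Let $q$ be a prime power, $k \ge 4$, $0<\varepsilon<1$, and let $\mathcal{C} \subseteq \mathbb{F}_q^n$ be an (unweighted) linear code of dimension $k$ and length $n \le k^{a}$. Then $\mathcal{C}$ has a $(1\pm\varepsilon)$-sparsifier of size at most $C_a \cdot k \log_2^2(k) \log_2(q) (\log_2\log_2 k)^2/\varepsilon^2$.
   Context: $\mathrm{wt}(v)$ is the number of nonzero coordinates of $v$. A $(1\pm\varepsilon)$-sparsifier of size $s$ for a code $\mathcal{C}\subseteq\mathbb{F}_q^n$ is a subset $S\subseteq[n]$, $|S|\le s$, with nonnegative weights $(w'_i)_{i\in S}$ such that for every $v\in\mathcal{C}$, $(1-\varepsilon)\mathrm{wt}(v)\le \sum_{i\in S: v_i\ne 0} w'_i \le (1+\varepsilon)\mathrm{wt}(v)$. *)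

theory Defs
  imports "HOL-Algebra.Algebra" "HOL-Library.FuncSet" Complex_Main
begin

definition vecs :: "('a, 'b) ring_scheme \<Rightarrow> nat \<Rightarrow> (nat \<Rightarrow> 'a) set" where
  "vecs R n = ({..<n} \<rightarrow>\<^sub>E carrier R)"

definition lincomb :: "('a, 'b) ring_scheme \<Rightarrow> nat \<Rightarrow> nat \<Rightarrow> (nat \<Rightarrow> nat \<Rightarrow> 'a) \<Rightarrow> (nat \<Rightarrow> 'a) \<Rightarrow> (nat \<Rightarrow> 'a)" where
  "lincomb R n k b c = restrict (\<lambda>i. finsum R (\<lambda>j. c j \<otimes>\<^bsub>R\<^esub> b j i) {..<k}) {..<n}"

definition linear_code :: "('a, 'b) ring_scheme \<Rightarrow> nat \<Rightarrow> nat \<Rightarrow> (nat \<Rightarrow> 'a) set \<Rightarrow> bool" where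
  "linear_code R n k C \<longleftrightarrow>
     (\<exists>b. (\<forall>j<k. b j \<in> vecs R n)
        \<and> inj_on (lincomb R n k b) ({..<k} \<rightarrow>\<^sub>E carrier R)
        \<and> C = lincomb R n k b ` ({..<k} \<rightarrow>\<^sub>E carrier R))"

definition wt :: "('a, 'b) ring_scheme \<Rightarrow> nat \<Rightarrow> (nat \<Rightarrow> 'a) \<Rightarrow> nat" where
  "wt R n v = card {i\<in>{..<n}. v i \<noteq> \<zero>\<^bsub>R\<^esub>}"

definition has_sparsifier :: "('a, 'b) ring_scheme \<Rightarrow> nat \<Rightarrow> (nat \<Rightarrow> 'a) set \<Rightarrow> real \<Rightarrow> real \<Rightarrow> bool" where
  "has_sparsifier R n C eps s \<longleftrightarrow>
     (\<exists>S (w :: nat \<Rightarrow> real). S \<subseteq> {..<n} \<and> real (card S) \<le> s \<and> (\<forall>i\<in>S. w i \<ge> 0) \<and>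
        (\<forall>v\<in>C. (1 - eps) * real (wt R n v) \<le> (\<Sum>i\<in>{i\<in>S. v i \<noteq> \<zero>\<^bsub>R\<^esub>}. w i)
              \<and> (\<Sum>i\<in>{i\<in>S. v i \<noteq> \<zero>\<^bsub>R\<^esub>}. w i) \<le> (1 + eps) * real (wt R n v)))"

end

theory Submission
  imports Defs
begin

text \<open>
  Importance sampling in the style of Benczur and Karger, with dimension playing the role of the
  number of vertices. Deleting the support of every subcode that is too short for its dimension
  leaves a set of coordinates on which each subcode of dimension d has support at least s d.
  Doing this for s = 1, 2, 4, ... gives a decreasing chain of coordinate sets G j, and a
  coordinate whose last level is j gets the importance x = 1 / 2^j. With these weights every
  subcode still has weighted support at least its dimension on each G j, and contracting a random
  coordinate then shows, as in Karger's cut counting, that there are few light codewords.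
  Sampling i with probability proportional to x i therefore preserves the x-weight of all
  codewords on all levels G j simultaneously. Finally the ordinary Hamming weight is a positive
  combination of these x-weights, so that the relative errors do not add up over the levels.
\<close>

section \<open>Independent sampling of a finite set\<close>

lemma exp_le_quadratic:
  fixes y :: real
  assumes "\<bar>y\<bar> \<le> 1"
  shows "exp y \<le> 1 + y + y\<^sup>2"
proof (cases "0 \<le> y")
  case True
  then show ?thesis using exp_bound[of y] assms by simp
next
  case False
  have "1 \<le> (1 - y) * (1 + y + y\<^sup>2)"
  proof -
    have "(1 - y) * (1 + y + y\<^sup>2) = 1 - y ^ 3" by (simp add: algebra_simps power2_eq_square power3_eq_cube)
    moreover have "y ^ 3 \<le> 0" using False by (simp add: power_le_zero_eq)
    ultimately show ?thesis by simp
  qed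
  also have "\<dots> \<le> exp (- y) * (1 + y + y\<^sup>2)"
  proof (rule mult_right_mono)
    show "1 - y \<le> exp (- y)" using exp_ge_add_one_self[of "- y"] by simp
    show "0 \<le> 1 + y + y\<^sup>2" using assms by (smt (verit) zero_le_power2)
  qed
  finally show ?thesis by (simp add: exp_minus field_simps)
qed

text \<open>After factoring out \<open>exp (- (l * p))\<close>, the bound 1 + z \<le> exp z leaves
  \<open>p * (exp l - 1 - l)\<close>, which is quadratic in \<open>l\<close>. The factor
  \<open>p\<close> in the exponent reflects the variance and lets the error scale with the
  importance.\<close>

lemma bernoulli_exp_moment:
  fixes p l :: real
  assumes "0 \<le> p" "\<bar>l\<bar> \<le> 1"
  shows "p * exp (l * (1 - p)) + (1 - p) * exp (- (l * p)) \<le> exp (l\<^sup>2 * p)"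
proof -
  have "p * exp (l * (1 - p)) + (1 - p) * exp (- (l * p)) = exp (- (l * p)) * (1 + p * (exp l - 1))"
  proof -
    have "exp (l * (1 - p)) = exp (- (l * p)) * exp l"
      unfolding exp_add[symmetric] by (simp add: algebra_simps)
    then show ?thesis by (simp add: algebra_simps)
  qed
  also have "\<dots> \<le> exp (- (l * p)) * exp (p * (exp l - 1))" by (intro mult_left_mono) auto
  also have "\<dots> = exp (p * (exp l - 1 - l))" by (simp add: exp_add[symmetric] algebra_simps)
  also have "\<dots> \<le> exp (p * l\<^sup>2)" using exp_le_quadratic[OF assms(2)] assms(1)
    by (simp add: mult_left_mono)
  finally show ?thesis by (simp add: mult.commute)
qed

section \<open>Random subsets with independent membership\<close>

text \<open>For \<open>S\<close> inside \<open>A\<close>, the probability that a random subset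
  containing each \<open>i\<close> independently with probability \<open>p i\<close> equals
  \<open>S\<close>. Expectations are finite sums over \<open>Pow A\<close> against this
  weight.\<close>

definition bernoulli_weight :: "('i \<Rightarrow> real) \<Rightarrow> 'i set \<Rightarrow> 'i set \<Rightarrow> real" where
  "bernoulli_weight p A S = (\<Prod>i\<in>S. p i) * (\<Prod>i\<in>A - S. 1 - p i)"

text \<open>Independence: expanding the product of sums over all subsets shows that the expectation
  of a product of one-coordinate functions factors.\<close>

lemma bernoulli_weight_prod:
  fixes p :: "'i \<Rightarrow> real"
  assumes "finite A"
  shows "(\<Sum>S\<in>Pow A. bernoulli_weight p A S * (\<Prod>i\<in>A. if i \<in> S then f i else g i))
    = (\<Prod>i\<in>A. p i * f i + (1 - p i) * g i)"
proof -
  have "(\<Prod>i\<in>A. if i \<in> S then f i else g i) = (\<Prod>i\<in>S. f i) * (\<Prod>i\<in>A - S. g i)" if "S \<subseteq> A" for S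
  proof -
    have "A \<inter> {i. i \<in> S} = S" "A \<inter> - {i. i \<in> S} = A - S" using that by auto
    then show ?thesis using assms by (simp add: prod.If_cases)
  qed
  then show ?thesis
    unfolding bernoulli_weight_def prod_add[OF assms]
    by (intro sum.cong) (auto simp: prod.distrib)
qed

lemma bernoulli_weight_sum:
  assumes "finite A"
  shows "(\<Sum>S\<in>Pow A. bernoulli_weight p A S) = 1"
  using bernoulli_weight_prod[OF assms, of p "\<lambda>_. 1" "\<lambda>_. 1"] by simp

lemma bernoulli_weight_card:
  assumes "finite A"
  shows "(\<Sum>S\<in>Pow A. bernoulli_weight p A S * real (card S)) = (\<Sum>i\<in>A. p i)"
proof -
  have mem: "(\<Sum>S\<in>Pow A. bernoulli_weight p A S * of_bool (j \<in> S)) = p j" if "j \<in> A" for j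
  proof -
    \<comment> \<open>The event that \<open>j\<close> is sampled, written as a product of
      one-coordinate functions so that the factorization applies.\<close>
    have "(\<Prod>i\<in>A. if i \<in> S then 1 else (if i = j then 0 else 1)) = (of_bool (j \<in> S) :: real)" for S
    proof -
      have "(\<Prod>i\<in>A. if i \<in> S then 1 else (if i = j then 0 else 1 :: real))
          = (\<Prod>i\<in>A. if i = j then of_bool (j \<in> S) else 1)" by (intro prod.cong) auto
      then show ?thesis using that assms by simp
    qed
    then have "(\<Sum>S\<in>Pow A. bernoulli_weight p A S * of_bool (j \<in> S))
        = (\<Prod>i\<in>A. p i * 1 + (1 - p i) * (if i = j then 0 else 1))"
      using bernoulli_weight_prod[OF assms, of p "\<lambda>_. 1" "\<lambda>i. if i = j then 0 else 1"] by simp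
    also have "\<dots> = (\<Prod>i\<in>A. if i = j then p i else 1)" by (intro prod.cong) auto
    finally show ?thesis using that assms by simp
  qed
  have "real (card S) = (\<Sum>j\<in>A. of_bool (j \<in> S))" if "S \<subseteq> A" for S
    using that assms by (simp add: Int_absorb1 Int_commute)
  then have "(\<Sum>S\<in>Pow A. bernoulli_weight p A S * real (card S))
      = (\<Sum>S\<in>Pow A. \<Sum>j\<in>A. bernoulli_weight p A S * of_bool (j \<in> S))"
    by (intro sum.cong) (auto simp: sum_distrib_left)
  also have "\<dots> = (\<Sum>i\<in>A. p i)" by (subst sum.swap) (simp add: mem)
  finally show ?thesis .
qed

text \<open>First-moment method: the weights are nonnegative and sum to one, so \<open>f\<close>
  cannot exceed its mean everywhere.\<close>

lemma bernoulli_weight_exists_le: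
  assumes "finite A" "\<And>i. i \<in> A \<Longrightarrow> 0 \<le> p i" "\<And>i. i \<in> A \<Longrightarrow> p i \<le> 1"
  shows "\<exists>S\<subseteq>A. f S \<le> (\<Sum>S\<in>Pow A. bernoulli_weight p A S * f S)"
proof (rule ccontr)
  define m where "m = (\<Sum>S\<in>Pow A. bernoulli_weight p A S * f S)"
  have nonneg: "0 \<le> bernoulli_weight p A S" if "S \<in> Pow A" for S
    using that assms unfolding bernoulli_weight_def by (intro mult_nonneg_nonneg prod_nonneg) auto
  assume "\<not> ?thesis"
  then have lt: "m < f S" if "S \<in> Pow A" for S using that unfolding m_def by (auto simp: not_le)
  have "\<exists>S\<in>Pow A. 0 < bernoulli_weight p A S"
  proof (rule ccontr)
    assume "\<not> ?thesis"
    then have "(\<Sum>S\<in>Pow A. bernoulli_weight p A S) \<le> 0" by (intro sum_nonpos) (auto simp: not_less)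
    then show False using bernoulli_weight_sum[OF assms(1)] by simp
  qed
  then obtain S where S: "S \<in> Pow A" "0 < bernoulli_weight p A S" by blast
  have "(\<Sum>S\<in>Pow A. bernoulli_weight p A S * m) < (\<Sum>S\<in>Pow A. bernoulli_weight p A S * f S)"
  proof (rule sum_strict_mono_ex1)
    show "\<forall>S\<in>Pow A. bernoulli_weight p A S * m \<le> bernoulli_weight p A S * f S"
      using nonneg less_imp_le[OF lt] by (intro ballI mult_left_mono)
    show "\<exists>S\<in>Pow A. bernoulli_weight p A S * m < bernoulli_weight p A S * f S"
      using S lt by (intro bexI[of _ S] mult_strict_left_mono)
  qed (use assms(1) in simp)
  then show False
    using bernoulli_weight_sum[OF assms(1), of p] unfolding m_def[symmetric] by (simp add: sum_distrib_right[symmetric])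
qed

text \<open>Estimated minus true \<open>x\<close>-weight of \<open>B\<close>, where a sampled
  coordinate is scaled by \<open>w i\<close> and an unsampled one counts as zero.\<close>

definition sampling_error :: "('i \<Rightarrow> real) \<Rightarrow> ('i \<Rightarrow> real) \<Rightarrow> 'i set \<Rightarrow> 'i set \<Rightarrow> real" where
  "sampling_error x w S B = (\<Sum>i\<in>B. x i * ((if i \<in> S then w i else 0) - 1))"

text \<open>Coordinates with \<open>rho * x i\<close> \<ge> 1 are always kept and make no error. For
  the others \<open>p i = rho * x i\<close>, and scaling the error by \<open>rho\<close> turns it
  into a centred Bernoulli variable; independence then multiplies the moments.\<close>

lemma sampling_exp_moment:
  fixes x :: "'i \<Rightarrow> real"
  assumes A: "finite A" "B \<subseteq> A" and x0: "\<And>i. 0 \<le> x i" and rho: "0 < rho" and l: "\<bar>l\<bar> \<le> 1"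
    and p: "p = (\<lambda>i. min 1 (rho * x i))"
  shows "(\<Sum>S\<in>Pow A. bernoulli_weight p A S * exp (l * rho * sampling_error x (\<lambda>i. 1 / p i) S B))
    \<le> exp (l\<^sup>2 * rho * (\<Sum>i\<in>B. x i))"
proof -
  define f where "f i = (if i \<in> B then exp (l * rho * (x i * (1 / p i - 1))) else 1)" for i
  define g where "g i = (if i \<in> B then exp (l * rho * (x i * (0 - 1))) else 1)" for i
  define h where "h i = (if i \<in> B then exp (l\<^sup>2 * rho * x i) else 1)" for i
  have AB: "A \<inter> {i. i \<in> B} = B" "A \<inter> B = B" using A(2) by auto
  have finB: "finite B" using A finite_subset by blast
  have "exp (l * rho * sampling_error x (\<lambda>i. 1 / p i) S B) = (\<Prod>i\<in>A. if i \<in> S then f i else g i)" for S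
  proof -
    have "(\<Prod>i\<in>A. if i \<in> S then f i else g i)
        = (\<Prod>i\<in>A. if i \<in> B then exp (l * rho * (x i * ((if i \<in> S then 1 / p i else 0) - 1))) else 1)"
      by (intro prod.cong) (auto simp: f_def g_def)
    also have "\<dots> = (\<Prod>i\<in>B. exp (l * rho * (x i * ((if i \<in> S then 1 / p i else 0) - 1))))"
      using A(1) by (simp add: prod.If_cases AB)
    also have "\<dots> = exp (l * rho * sampling_error x (\<lambda>i. 1 / p i) S B)"
      using finB unfolding sampling_error_def by (simp add: exp_sum sum_distrib_left)
    finally show ?thesis by simp
  qed
  then have "(\<Sum>S\<in>Pow A. bernoulli_weight p A S * exp (l * rho * sampling_error x (\<lambda>i. 1 / p i) S B))
      = (\<Prod>i\<in>A. p i * f i + (1 - p i) * g i)"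
    by (simp add: bernoulli_weight_prod[OF A(1)])
  also have "\<dots> \<le> (\<Prod>i\<in>A. h i)"
  proof (rule prod_mono, intro conjI)
    fix i
    have p01: "0 \<le> p i" "p i \<le> 1" using x0[of i] rho by (auto simp: p)
    show "0 \<le> p i * f i + (1 - p i) * g i" using p01 unfolding f_def g_def by simp
    show "p i * f i + (1 - p i) * g i \<le> h i"
    proof (cases "i \<in> B")
      case False
      then show ?thesis unfolding f_def g_def h_def by simp
    next
      case B: True
      consider "x i = 0" | "1 \<le> rho * x i" | "0 < x i" "rho * x i < 1" using x0[of i] by linarith
      then show ?thesis
      proof cases
        case 1
        then show ?thesis unfolding f_def g_def h_def by simp
      next
        case 2
        then have "p i = 1" by (simp add: p)
        then show ?thesis using B x0[of i] rho unfolding f_def h_def by simp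
      next
        case 3
        then have pi: "p i = rho * x i" by (simp add: p)
        have "l * rho * (x i * (1 / p i - 1)) = l * (1 - p i)" using 3 rho unfolding pi by (simp add: field_simps)
        then have f: "f i = exp (l * (1 - p i))" using B unfolding f_def by simp
        have g: "g i = exp (- (l * p i))" using B unfolding g_def pi by (simp add: mult.assoc)
        have h: "h i = exp (l\<^sup>2 * p i)" using B unfolding h_def pi by (simp add: mult.assoc)
        show ?thesis unfolding f g h using bernoulli_exp_moment[OF p01(1) l] .
      qed
    qed
  qed
  also have "\<dots> = exp (l\<^sup>2 * rho * (\<Sum>i\<in>B. x i))"
    using A(1) finB unfolding h_def by (simp add: prod.If_cases AB exp_sum sum_distrib_left)
  finally show ?thesis .
qed

text \<open>Chernoff bound and union bound with costs \<open>b t\<close>. Failure cost and sample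
  size are put into one potential of mean below 1, so a single \<open>S\<close> controls
  both.\<close>

lemma importance_sampling:
  fixes x :: "'i \<Rightarrow> real" and b :: "'t \<Rightarrow> real"
  assumes A: "finite A" and T: "finite T" "\<And>t. t \<in> T \<Longrightarrow> B t \<subseteq> A" and x0: "\<And>i. 0 \<le> x i"
    and rho: "0 < rho" and eps: "0 < eps" "eps \<le> 1" and b0: "\<And>t. 0 \<le> b t"
    and small: "(\<Sum>t\<in>T. b t * exp (- (rho * eps\<^sup>2 / 4) * (\<Sum>i\<in>B t. x i))) < 1 / 4"
    and K: "rho * (\<Sum>i\<in>A. x i) \<le> K" "0 < K"
  obtains S w where "S \<subseteq> A" "\<And>i. 0 \<le> w i" "real (card S) \<le> 2 * K"
    "(\<Sum>t\<in>{t\<in>T. eps * (\<Sum>i\<in>B t. x i) < \<bar>sampling_error x w S (B t)\<bar>}. b t) < 1"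
proof -
  define p where "p = (\<lambda>i. min 1 (rho * x i))"
  define w where "w = (\<lambda>i. 1 / p i)"
  \<comment> \<open>This value minimizes \<open>lam\<^sup>2 - lam * eps\<close>, the coefficient of
    \<open>rho * mu t\<close> in the exponent; the minimum is
    \<open>- eps\<^sup>2 / 4\<close>.\<close>
  define lam where "lam = eps / 2"
  define mu where "mu t = (\<Sum>i\<in>B t. x i)" for t
  define Y where "Y S t = sampling_error x w S (B t)" for S t
  define E where "E f = (\<Sum>S\<in>Pow A. bernoulli_weight p A S * f S)" for f :: "'i set \<Rightarrow> real"
  \<comment> \<open>An upper bound for the indicator of failure at \<open>t\<close>; the two
    exponentials cover the two signs of the error.\<close>
  define F where "F S t = exp (- (lam * rho * eps * mu t)) * (exp (lam * rho * Y S t) + exp (- lam * rho * Y S t))" for S t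
  \<comment> \<open>In the mean the first summand stays below 1/2 and the second is at most
    1/2.\<close>
  define Phi where "Phi S = (\<Sum>t\<in>T. b t * F S t) + real (card S) / (2 * K)" for S
  have p01: "0 \<le> p i" "p i \<le> 1" for i using x0[of i] rho by (auto simp: p_def)
  have mu0: "0 \<le> mu t" for t unfolding mu_def by (simp add: sum_nonneg x0)
  have moment: "E (\<lambda>S. exp (lam' * rho * Y S t)) \<le> exp (lam\<^sup>2 * rho * mu t)"
    if "t \<in> T" "lam' = lam \<or> lam' = - lam" for t lam'
    using sampling_exp_moment[OF A T(2)[OF that(1)] x0 rho, of lam' p] that eps
    unfolding E_def Y_def w_def mu_def p_def lam_def by auto
  have EF: "E (\<lambda>S. F S t) \<le> 2 * exp (- (rho * eps\<^sup>2 / 4) * mu t)" if t: "t \<in> T" for t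
  proof -
    have "E (\<lambda>S. F S t) = exp (- (lam * rho * eps * mu t)) *
        (E (\<lambda>S. exp (lam * rho * Y S t)) + E (\<lambda>S. exp (- lam * rho * Y S t)))"
      unfolding E_def F_def by (simp add: sum_distrib_left sum.distrib[symmetric] algebra_simps)
    also have "\<dots> \<le> exp (- (lam * rho * eps * mu t)) * (exp (lam\<^sup>2 * rho * mu t) + exp (lam\<^sup>2 * rho * mu t))"
      using moment[OF t, of lam] moment[OF t, of "- lam"] by (intro mult_left_mono add_mono) auto
    also have "\<dots> = 2 * exp (- (rho * eps\<^sup>2 / 4) * mu t)"
      unfolding lam_def by (simp add: exp_add[symmetric] field_simps power2_eq_square)
    finally show ?thesis .
  qed
  have "E (\<lambda>S. \<Sum>t\<in>T. b t * F S t) = (\<Sum>S\<in>Pow A. \<Sum>t\<in>T. b t * (bernoulli_weight p A S * F S t))"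
    unfolding E_def by (simp add: sum_distrib_left mult.left_commute)
  also have "\<dots> = (\<Sum>t\<in>T. b t * E (\<lambda>S. F S t))"
    unfolding E_def by (subst sum.swap) (simp add: sum_distrib_left)
  finally have "E Phi = (\<Sum>t\<in>T. b t * E (\<lambda>S. F S t)) + E (\<lambda>S. real (card S)) / (2 * K)"
    unfolding E_def Phi_def by (simp add: distrib_left sum.distrib sum_divide_distrib)
  also have "\<dots> \<le> (\<Sum>t\<in>T. b t * (2 * exp (- (rho * eps\<^sup>2 / 4) * mu t))) + K / (2 * K)"
  proof (intro add_mono sum_mono mult_left_mono EF b0 divide_right_mono)
    have "E (\<lambda>S. real (card S)) = (\<Sum>i\<in>A. p i)" unfolding E_def by (rule bernoulli_weight_card[OF A])
    also have "\<dots> \<le> (\<Sum>i\<in>A. rho * x i)" unfolding p_def by (intro sum_mono) simp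
    finally show "E (\<lambda>S. real (card S)) \<le> K" using K(1) by (simp add: sum_distrib_left)
  qed (use K(2) in auto)
  also have "\<dots> = 2 * (\<Sum>t\<in>T. b t * exp (- (rho * eps\<^sup>2 / 4) * mu t)) + 1 / 2"
    using K(2) by (simp add: sum_distrib_left algebra_simps)
  also have "\<dots> < 1" using small unfolding mu_def[symmetric] by linarith
  finally have "E Phi < 1" .
  moreover have "\<exists>S\<subseteq>A. Phi S \<le> E Phi"
    unfolding E_def using A p01 by (rule bernoulli_weight_exists_le)
  then obtain S where S: "S \<subseteq> A" "Phi S \<le> E Phi" by (elim exE conjE)
  ultimately have Phi: "Phi S < 1" by linarith
  have F0: "0 \<le> F S t" for t unfolding F_def by simp
  have F1: "1 \<le> F S t" if "eps * mu t < \<bar>Y S t\<bar>" for t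
  proof -
    have "0 < lam * rho" using eps rho unfolding lam_def by simp
    then have "lam * rho * (eps * mu t) \<le> lam * rho * \<bar>Y S t\<bar>"
      using that by (intro mult_left_mono) auto
    then have "exp (lam * rho * (eps * mu t)) \<le> exp (lam * rho * \<bar>Y S t\<bar>)" by simp
    also have "\<dots> \<le> exp (lam * rho * Y S t) + exp (- lam * rho * Y S t)" by (simp add: abs_if)
    finally show ?thesis unfolding F_def by (simp add: exp_minus field_simps)
  qed
  have "(\<Sum>t\<in>{t\<in>T. eps * mu t < \<bar>Y S t\<bar>}. b t) \<le> (\<Sum>t\<in>{t\<in>T. eps * mu t < \<bar>Y S t\<bar>}. b t * F S t)"
  proof (rule sum_mono)
    fix t assume "t \<in> {t\<in>T. eps * mu t < \<bar>Y S t\<bar>}"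
    then have "b t * 1 \<le> b t * F S t" using F1 b0 by (intro mult_left_mono) auto
    then show "b t \<le> b t * F S t" by simp
  qed
  also have "\<dots> \<le> (\<Sum>t\<in>T. b t * F S t)" using T(1) b0 F0 by (intro sum_mono2) auto
  also have "\<dots> \<le> Phi S" unfolding Phi_def using K(2) by simp
  finally have bad: "(\<Sum>t\<in>{t\<in>T. eps * mu t < \<bar>Y S t\<bar>}. b t) < 1" using Phi by simp
  have "real (card S) / (2 * K) \<le> Phi S" unfolding Phi_def using b0 F0 by (simp add: sum_nonneg)
  then have "real (card S) / (2 * K) \<le> 1" using Phi by simp
  then have "real (card S) \<le> 2 * K" using K(2) by (simp add: field_simps)
  then show thesis using that[OF S(1), of w] p01 bad unfolding mu_def Y_def w_def by simp
qed

section \<open>Subspaces and rank\<close>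

locale coordinate_space = field R for R :: "('a, 'b) ring_scheme" (structure) +
  fixes n :: nat
  assumes finite_carrier: "finite (carrier R)"
begin

section \<open>Subspaces, shortening and cardinality\<close>

definition axpy :: "'a \<Rightarrow> (nat \<Rightarrow> 'a) \<Rightarrow> (nat \<Rightarrow> 'a) \<Rightarrow> nat \<Rightarrow> 'a" where
  "axpy c u v = (\<lambda>i\<in>{..<n}. c \<otimes> u i \<oplus> v i)"

definition subsp :: "(nat \<Rightarrow> 'a) set \<Rightarrow> bool" where
  "subsp V \<longleftrightarrow> V \<subseteq> vecs R n \<and> (\<lambda>i\<in>{..<n}. \<zero>) \<in> V \<and>
     (\<forall>c\<in>carrier R. \<forall>u\<in>V. \<forall>v\<in>V. axpy c u v \<in> V)"

text \<open>Kernel of the restriction of \<open>V\<close> to \<open>A\<close>: shortening of a code,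
  or contraction in matroid terms.\<close>

definition Ann :: "(nat \<Rightarrow> 'a) set \<Rightarrow> nat set \<Rightarrow> (nat \<Rightarrow> 'a) set" where
  "Ann V A = {v \<in> V. \<forall>i\<in>A. v i = \<zero>}"

definition supp :: "(nat \<Rightarrow> 'a) set \<Rightarrow> nat set" where
  "supp V = {i. i < n \<and> (\<exists>v\<in>V. v i \<noteq> \<zero>)}"

abbreviation q :: nat where "q \<equiv> card (carrier R)"

lemma q_ge_2: "2 \<le> q"
proof -
  have "card {\<zero>, \<one>} \<le> q"
    by (rule card_mono) (auto simp: finite_carrier)
  then show ?thesis by simp
qed

lemma finite_vecs: "finite (vecs R n)"
  unfolding vecs_def by (intro finite_PiE) (auto simp: finite_carrier)

lemma subsp_finite: "subsp V \<Longrightarrow> finite V"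
  unfolding subsp_def using finite_vecs finite_subset by blast

lemma subsp_carrier: "subsp V \<Longrightarrow> v \<in> V \<Longrightarrow> i < n \<Longrightarrow> v i \<in> carrier R"
  unfolding subsp_def vecs_def by (auto simp: PiE_def Pi_def)

lemma subsp_axpy: "subsp V \<Longrightarrow> c \<in> carrier R \<Longrightarrow> u \<in> V \<Longrightarrow> v \<in> V \<Longrightarrow> axpy c u v \<in> V"
  unfolding subsp_def by blast

lemma subsp_zero: "subsp V \<Longrightarrow> (\<lambda>i\<in>{..<n}. \<zero>) \<in> V"
  unfolding subsp_def by blast

lemma subsp_ext:
  assumes "subsp V" "u \<in> V" "v \<in> V" "\<And>i. i < n \<Longrightarrow> u i = v i"
  shows "u = v"
proof -
  have "u \<in> vecs R n" "v \<in> vecs R n" using assms unfolding subsp_def by auto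
  then show ?thesis unfolding vecs_def by (intro PiE_ext) (auto intro: assms(4))
qed

lemma Ann_subset: "Ann V A \<subseteq> V"
  unfolding Ann_def by blast

lemma Ann_Ann: "A \<subseteq> B \<Longrightarrow> Ann (Ann V A) B = Ann V B"
  unfolding Ann_def by blast

lemma Ann_insert: "Ann V (insert i A) = Ann (Ann V A) {i}"
  unfolding Ann_def by blast

lemma Ann_Int_supp: "A \<subseteq> {..<n} \<Longrightarrow> Ann V (supp V \<inter> A) = Ann V A"
  unfolding Ann_def supp_def by blast

lemma subsp_Ann:
  assumes "subsp V" "A \<subseteq> {..<n}"
  shows "subsp (Ann V A)"
  using assms unfolding subsp_def Ann_def axpy_def by (auto simp: subset_iff)

text \<open>Fixing \<open>v0\<close> in \<open>V\<close> with \<open>v0 i\<close> nonzero, each word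
  of \<open>V\<close> is uniquely a multiple of \<open>v0\<close> plus a word vanishing at
  \<open>i\<close>.\<close>

lemma card_Ann_singleton:
  assumes V: "subsp V" and i: "i \<in> supp V"
  shows "card V = q * card (Ann V {i})"
proof -
  obtain v0 where v0: "v0 \<in> V" "v0 i \<noteq> \<zero>" and n: "i < n" using i unfolding supp_def by blast
  have c0: "v0 i \<in> carrier R" and u0: "v0 i \<in> Units R"
    using subsp_carrier[OF V v0(1) n] v0(2) field_Units by auto
  have A: "subsp (Ann V {i})" using subsp_Ann[OF V] n by simp
  have "bij_betw (\<lambda>(c, u). axpy c v0 u) (carrier R \<times> Ann V {i}) V"
  proof (rule bij_betw_imageI)
    show "inj_on (\<lambda>(c, u). axpy c v0 u) (carrier R \<times> Ann V {i})"
    proof (rule inj_onI, clarify)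
      fix c u c' u'
      assume c: "c \<in> carrier R" "c' \<in> carrier R" and u: "u \<in> Ann V {i}" "u' \<in> Ann V {i}"
        and eq: "axpy c v0 u = axpy c' v0 u'"
      have "u i = \<zero>" "u' i = \<zero>" using u unfolding Ann_def by auto
      then have "c \<otimes> v0 i = c' \<otimes> v0 i"
        using fun_cong[OF eq, of i] n c c0 by (simp add: axpy_def)
      then have "c = c'" using c c0 v0(2) by (simp add: m_rcancel)
      moreover have "u = u'"
      proof (rule subsp_ext[OF A u])
        fix j assume j: "j < n"
        have "u j \<in> carrier R" "u' j \<in> carrier R" "v0 j \<in> carrier R"
          using subsp_carrier[OF A u(1) j] subsp_carrier[OF A u(2) j] subsp_carrier[OF V v0(1) j] by auto
        then show "u j = u' j"
          using fun_cong[OF eq, of j] j c \<open>c = c'\<close> by (simp add: axpy_def)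
      qed
      ultimately show "c = c' \<and> u = u'" by simp
    qed
    show "(\<lambda>(c, u). axpy c v0 u) ` (carrier R \<times> Ann V {i}) = V"
    proof (intro equalityI subsetI)
      fix w assume "w \<in> (\<lambda>(c, u). axpy c v0 u) ` (carrier R \<times> Ann V {i})"
      then show "w \<in> V" using subsp_axpy[OF V] v0(1) Ann_subset by fastforce
    next
      fix w assume w: "w \<in> V"
      have wi: "w i \<in> carrier R" using subsp_carrier[OF V w n] .
      define c where "c = w i \<otimes> inv (v0 i)"
      have c: "c \<in> carrier R" using wi u0 unfolding c_def by auto
      have cv: "c \<otimes> v0 i = w i" using wi u0 c0 unfolding c_def by (simp add: m_assoc)
      define u where "u = axpy (\<ominus> c) v0 w"
      have uV: "u \<in> V" unfolding u_def using subsp_axpy[OF V] c v0 w by simp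
      have "u i = \<zero>" unfolding u_def axpy_def using n c c0 wi cv by (simp add: l_minus l_neg)
      then have uA: "u \<in> Ann V {i}" using uV unfolding Ann_def by auto
      have "w = axpy c v0 u"
      proof (rule subsp_ext[OF V w])
        show "axpy c v0 u \<in> V" using subsp_axpy[OF V] c v0 uV by simp
        fix j assume j: "j < n"
        have "w j \<in> carrier R" "v0 j \<in> carrier R"
          using subsp_carrier[OF V w j] subsp_carrier[OF V v0(1) j] by auto
        then show "w j = axpy c v0 u j"
          unfolding u_def axpy_def using j c by (simp add: l_minus r_neg2)
      qed
      then show "w \<in> (\<lambda>(c, u). axpy c v0 u) ` (carrier R \<times> Ann V {i})"
        using c uA by (intro image_eqI[of _ _ "(c, u)"]) auto
    qed
  qed
  then have "card V = card (carrier R \<times> Ann V {i})" by (simp add: bij_betw_same_card)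
  then show ?thesis by (simp add: card_cartesian_product)
qed

lemma Ann_singleton_eq: "i < n \<Longrightarrow> i \<notin> supp V \<Longrightarrow> Ann V {i} = V"
  unfolding Ann_def supp_def by blast

lemma card_subsp_pos: "subsp V \<Longrightarrow> 0 < card V"
  using subsp_finite subsp_zero card_gt_0_iff by blast

text \<open>Shortening at a support coordinate divides the cardinality by \<open>q\<close>; this is
  repeated until only the zero word remains. No basis is chosen.\<close>

lemma card_subsp: "subsp V \<Longrightarrow> \<exists>d. card V = q ^ d"
proof (induction "card V" arbitrary: V rule: less_induct)
  case less
  show ?case
  proof (cases "supp V = {}")
    case True
    have "V = {\<lambda>i\<in>{..<n}. \<zero>}"
    proof -
      have "v = (\<lambda>i\<in>{..<n}. \<zero>)" if "v \<in> V" for v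
        using that True subsp_zero[OF less.prems]
        by (intro subsp_ext[OF less.prems]) (auto simp: supp_def)
      then show ?thesis using subsp_zero[OF less.prems] by blast
    qed
    then have "card V = q ^ 0" by simp
    then show ?thesis by blast
  next
    case False
    then obtain i where i: "i \<in> supp V" by blast
    have A: "subsp (Ann V {i})" using subsp_Ann[OF less.prems] i by (simp add: supp_def)
    have eq: "card V = q * card (Ann V {i})" using card_Ann_singleton[OF less.prems i] .
    have "card (Ann V {i}) < card V" using eq q_ge_2 card_subsp_pos[OF A] by simp
    then obtain d where "card (Ann V {i}) = q ^ d" using less.hyps A by blast
    then have "card V = q ^ Suc d" using eq by simp
    then show ?thesis by blast
  qed
qed

section \<open>Dimension and rank\<close>

text \<open>Dimension, read off from the cardinality; the exponent is unique because
  \<open>q\<close> \<ge> 2.\<close>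

definition dm :: "(nat \<Rightarrow> 'a) set \<Rightarrow> nat" where
  "dm V = (THE d. card V = q ^ d)"

lemma dm_eqI: "card V = q ^ d \<Longrightarrow> dm V = d"
  unfolding dm_def using q_ge_2 by (intro the_equality) (auto simp: power_inject_exp)

lemma card_eq_dm: "subsp V \<Longrightarrow> card V = q ^ dm V"
  using card_subsp dm_eqI by metis

lemma dm_Ann_insert:
  assumes "subsp V" "A \<subseteq> {..<n}" "i < n"
  shows "dm (Ann V A) = dm (Ann V (insert i A)) + of_bool (i \<in> supp (Ann V A))"
proof -
  have A: "subsp (Ann V A)" "subsp (Ann V (insert i A))" using assms by (auto intro: subsp_Ann)
  show ?thesis
  proof (cases "i \<in> supp (Ann V A)")
    case True
    have "card (Ann V A) = q ^ Suc (dm (Ann V (insert i A)))"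
      using card_Ann_singleton[OF A(1) True] card_eq_dm[OF A(2)] by (simp add: Ann_insert[of V i A])
    then show ?thesis using True by (simp add: dm_eqI)
  next
    case False
    then show ?thesis using assms(3) by (simp add: Ann_insert[of V i A] Ann_singleton_eq)
  qed
qed

text \<open>By rank-nullity, the dimension of the restriction of \<open>V\<close> to
  \<open>A\<close>, hence the rank of \<open>A\<close> in the matroid of the code.\<close>

definition rk :: "(nat \<Rightarrow> 'a) set \<Rightarrow> nat set \<Rightarrow> nat" where
  "rk V A = dm V - dm (Ann V A)"

lemma Ann_empty: "Ann V {} = V"
  unfolding Ann_def by simp

lemma dm_Ann_le:
  assumes V: "subsp V" and A: "A \<subseteq> {..<n}"
  shows "dm (Ann V A) \<le> dm V"
proof -
  have "card (Ann V A) \<le> card V" using Ann_subset subsp_finite[OF V] card_mono by blast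
  then have "q ^ dm (Ann V A) \<le> q ^ dm V" using card_eq_dm[OF V] card_eq_dm[OF subsp_Ann[OF V A]] by simp
  then show ?thesis using q_ge_2 by (simp add: power_increasing_iff)
qed

lemma dm_eq_rk: "subsp V \<Longrightarrow> A \<subseteq> {..<n} \<Longrightarrow> dm V = rk V A + dm (Ann V A)"
  unfolding rk_def using dm_Ann_le by simp

lemma card_eq_rk:
  assumes "subsp V" "A \<subseteq> {..<n}"
  shows "card V = q ^ rk V A * card (Ann V A)"
  using card_eq_dm[OF assms(1)] card_eq_dm[OF subsp_Ann[OF assms]] dm_eq_rk[OF assms]
  by (simp add: power_add)

lemma rk_insert:
  assumes "subsp V" "A \<subseteq> {..<n}" "i < n"
  shows "rk V (insert i A) = rk V A + of_bool (i \<in> supp (Ann V A))"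
  using dm_Ann_insert[OF assms] dm_eq_rk[OF assms(1,2)] dm_eq_rk[OF assms(1), of "insert i A"] assms
  by simp

lemma rk_empty: "rk V {} = 0"
  unfolding rk_def Ann_empty by simp

text \<open>Coordinates are added one at a time: one that raises the rank for \<open>V\<close> lies
  in the support of \<open>Ann V A\<close>, hence in that of \<open>Ann U A\<close>.\<close>

lemma rk_mono:
  assumes "subsp V" "subsp U" "V \<subseteq> U" "A \<subseteq> {..<n}"
  shows "rk V A \<le> rk U A"
proof -
  have "finite A" using assms(4) finite_subset by blast
  then show ?thesis using assms(4)
  proof (induction A)
    case empty
    then show ?case by (simp add: rk_empty)
  next
    case (insert i A)
    have "supp (Ann V A) \<subseteq> supp (Ann U A)"
      using assms(3) unfolding supp_def Ann_def by blast
    then show ?case using insert assms(1,2) by (auto simp: rk_insert)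
  qed
qed

lemma rk_le_card:
  assumes "subsp V" "A \<subseteq> {..<n}"
  shows "rk V A \<le> card A"
proof -
  have "finite A" using assms(2) finite_subset by blast
  then show ?thesis using assms(2)
    by (induction A) (auto simp: rk_empty rk_insert assms(1))
qed

lemma rk_le_card_supp:
  assumes "subsp V" "A \<subseteq> {..<n}"
  shows "rk V A \<le> card (supp V \<inter> A)"
proof -
  have "rk V A = rk V (supp V \<inter> A)" using Ann_Int_supp[OF assms(2)] by (simp add: rk_def)
  then show ?thesis using rk_le_card[OF assms(1), of "supp V \<inter> A"] assms(2) by auto
qed

text \<open>Contracting \<open>A\<close> and then \<open>B\<close> is the same as contracting
  \<open>B\<close>, so the two drops in dimension add up.\<close>

lemma rk_chain:
  assumes "subsp V" "A \<subseteq> B" "B \<subseteq> {..<n}"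
  shows "rk V B = rk V A + rk (Ann V A) B"
proof -
  have A: "A \<subseteq> {..<n}" using assms by blast
  show ?thesis
    using dm_eq_rk[OF assms(1) A] dm_eq_rk[OF assms(1,3)] dm_eq_rk[OF subsp_Ann[OF assms(1) A] assms(3)]
    by (simp add: Ann_Ann[OF assms(2)])
qed

lemma rk_le_dm: "rk V A \<le> dm V"
  unfolding rk_def by simp

lemma rk_eq_0:
  assumes "subsp V" "A \<subseteq> {..<n}" "rk V A = 0"
  shows "Ann V A = V"
  by (rule card_subset_eq[OF subsp_finite[OF assms(1)] Ann_subset])
    (use card_eq_rk[OF assms(1,2)] assms(3) in simp)

section \<open>Dense coordinate sets\<close>

text \<open>The rank on \<open>G\<close> replaces the dimension, so words of \<open>V\<close> that
  vanish on \<open>G\<close> make no demand.\<close>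

definition dense :: "(nat \<Rightarrow> 'a) set \<Rightarrow> nat \<Rightarrow> nat set \<Rightarrow> bool" where
  "dense C d G \<longleftrightarrow> (\<forall>V. subsp V \<and> V \<subseteq> C \<longrightarrow> d * rk V G \<le> card (supp V \<inter> G))"

text \<open>Delete the support of a violating subspace \<open>V\<close> and repeat. Fewer than
  \<open>d * rk V G\<close> coordinates go, while the rank of \<open>C\<close> drops by at least
  \<open>rk V G\<close>, so the potential \<open>d * rk C G\<close> pays for all deletions.\<close>

lemma dense_subset_exists:
  assumes C: "subsp C" and "G \<subseteq> {..<n}"
  shows "\<exists>G'\<subseteq>G. dense C d G' \<and> card (G - G') + d * rk C G' \<le> d * rk C G"
  using assms(2)
proof (induction "card G" arbitrary: G rule: less_induct)
  case less
  show ?case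
  proof (cases "dense C d G")
    case True
    then show ?thesis by (intro exI[of _ G]) auto
  next
    case False
    then obtain V where V: "subsp V" "V \<subseteq> C" and lt: "card (supp V \<inter> G) < d * rk V G"
      unfolding dense_def by (auto simp: not_le)
    define G1 where "G1 = G - supp V"
    have fin: "finite G" using less.prems finite_subset by blast
    have G1: "G1 \<subseteq> G" "G1 \<subseteq> {..<n}" using less.prems unfolding G1_def by auto
    have "rk V G > 0" using lt by (cases "rk V G") auto
    then have "supp V \<inter> G \<noteq> {}" using rk_le_card_supp[OF V(1) less.prems] by (auto simp del: neq0_conv)
    then have "card G1 < card G" using fin unfolding G1_def by (intro psubset_card_mono) auto
    then obtain G' where G': "G' \<subseteq> G1" "dense C d G'"
        "card (G1 - G') + d * rk C G' \<le> d * rk C G1"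
      using less.hyps G1(2) by blast
    \<comment> \<open>\<open>V\<close> is invisible on \<open>G1\<close>, so all of its rank on
      \<open>G\<close> is lost by the deletion.\<close>
    have "V \<subseteq> Ann C G1" using V(2) less.prems unfolding G1_def Ann_def supp_def by blast
    then have "rk V G \<le> rk (Ann C G1) G"
      using rk_mono[OF V(1) subsp_Ann[OF C G1(2)] _ less.prems] by blast
    then have "rk C G1 + rk V G \<le> rk C G" using rk_chain[OF C G1(1) less.prems] by simp
    then have "d * rk C G1 + d * rk V G \<le> d * rk C G" by (metis distrib_left mult_le_mono2)
    moreover have "card (G - G') = card (supp V \<inter> G) + card (G1 - G')"
    proof -
      have "G - G' = (supp V \<inter> G) \<union> (G1 - G')" using G'(1) unfolding G1_def by blast
      moreover have "(supp V \<inter> G) \<inter> (G1 - G') = {}" unfolding G1_def by blast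
      ultimately show ?thesis using fin G1(1) by (metis card_Un_disjoint finite_Diff finite_Int finite_subset)
    qed
    ultimately have "card (G - G') + d * rk C G' \<le> d * rk C G" using lt G'(3) by simp
    then show ?thesis using G' G1 by blast
  qed
qed

lemma dense_chain:
  assumes C: "subsp C"
  obtains G :: "nat \<Rightarrow> nat set" where "G 0 = {..<n}" "\<And>j. G j \<subseteq> {..<n}" "\<And>j. G (Suc j) \<subseteq> G j"
    "\<And>j. dense C (2 ^ j) (G j)" "\<And>j. card (G j - G (Suc j)) \<le> 2 ^ Suc j * dm C"
proof -
  have "\<exists>G. \<forall>j. (G j \<subseteq> {..<n} \<and> dense C (2 ^ j) (G j) \<and> (j = 0 \<longrightarrow> G j = {..<n})) \<and>
      (G (Suc j) \<subseteq> G j \<and> card (G j - G (Suc j)) \<le> 2 ^ Suc j * dm C)"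
  proof (rule dependent_nat_choice, goal_cases)
    case 1
    \<comment> \<open>Density 1 holds on the full coordinate set, since a rank is at most the size
      of the support.\<close>
    show ?case using rk_le_card_supp by (intro exI[of _ "{..<n}"]) (auto simp: dense_def)
  next
    case (2 G j)
    then obtain G' where G': "G' \<subseteq> G" "dense C (2 ^ Suc j) G'"
        "card (G - G') + 2 ^ Suc j * rk C G' \<le> 2 ^ Suc j * rk C G"
      using dense_subset_exists[OF C, of G "2 ^ Suc j"] by blast
    have "2 ^ Suc j * rk C G \<le> 2 ^ Suc j * dm C" using rk_le_dm mult_le_mono2 by blast
    then have "card (G - G') \<le> 2 ^ Suc j * dm C" using G'(3) by linarith
    then show ?case using G' 2 by blast
  qed
  then obtain G where G: "\<forall>j. (G j \<subseteq> {..<n} \<and> dense C (2 ^ j) (G j) \<and> (j = 0 \<longrightarrow> G j = {..<n})) \<and>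
      (G (Suc j) \<subseteq> G j \<and> card (G j - G (Suc j)) \<le> 2 ^ Suc j * dm C)" ..
  show thesis by (rule that[of G]) (use G in blast)+
qed

end

section \<open>Counting light codewords\<close>

lemma one_minus_ge_exp:
  fixes y :: real
  assumes "0 \<le> y" "y \<le> 1 / 2"
  shows "exp (- (2 * y)) \<le> 1 - y"
proof -
  have "0 \<le> y * (1 - 2 * y)" using assms by simp
  then have "1 \<le> (1 - y) * (1 + 2 * y)" by (simp add: algebra_simps)
  also have "\<dots> \<le> (1 - y) * exp (2 * y)" using assms exp_ge_add_one_self[of "2 * y"] by (intro mult_left_mono) auto
  finally show ?thesis by (simp add: exp_minus field_simps)
qed

text \<open>Growth of the logarithm in one step; it pays for one contraction in the counting
  argument.\<close>

lemma inverse_le_ln_quotient: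
  fixes y :: real
  assumes "1 \<le> y"
  shows "1 / (y + 1) \<le> ln (y + 1) - ln y"
proof -
  have "ln (y / (y + 1)) \<le> y / (y + 1) - 1" using assms by (intro ln_le_minus_one) simp
  moreover have "y / (y + 1) - 1 = - (1 / (y + 1))" using assms by (simp add: field_simps)
  ultimately show ?thesis using assms by (simp add: ln_div)
qed

context coordinate_space
begin

text \<open>
  Split \<open>V\<close> along the chain: the part of \<open>V\<close> that vanishes on \<open>G (Suc j)\<close> is supported in \<open>G j\<close> only
  at coordinates of weight exactly \<open>1 / 2 ^ j\<close>, so density of \<open>G j\<close> pays for its rank.
\<close>

lemma level_weight_ge_rk:
  fixes G :: "nat \<Rightarrow> nat set" and x :: "nat \<Rightarrow> real"
  assumes C: "subsp C" and G: "\<And>j. G j \<subseteq> {..<n}" "\<And>j. G (Suc j) \<subseteq> G j"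
    and dense: "\<And>j. dense C (2 ^ j) (G j)" and J: "Ann C (G J) = C"
    and x: "\<And>i j. j < J \<Longrightarrow> i \<in> G j - G (Suc j) \<Longrightarrow> x i = 1 / 2 ^ j" and x0: "\<And>i. 0 \<le> x i"
    and "j \<le> J" "subsp V" "V \<subseteq> C"
  shows "real (rk V (G j)) \<le> (\<Sum>i\<in>G j \<inter> supp V. x i)"
  using assms(8-10)
proof (induction j rule: inc_induct)
  case base
  \<comment> \<open>All words of \<open>C\<close> vanish on \<open>G J\<close>, so the rank there is
    zero and the downward induction starts.\<close>
  then have "Ann V (G J) = V" using J unfolding Ann_def by blast
  then show ?case by (simp add: rk_def sum_nonneg x0)
next
  case (step j)
  let ?F = "(G j - G (Suc j)) \<inter> supp V"
  define V' where "V' = Ann V (G (Suc j))"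
  have V': "subsp V'" "V' \<subseteq> C"
    using subsp_Ann[OF step.prems(1) G(1)] step.prems(2) Ann_subset unfolding V'_def by blast+
  have fin: "finite (G j)" "finite (G (Suc j))" using G(1) finite_subset by blast+
  have sub: "supp V' \<inter> G j \<subseteq> ?F" unfolding V'_def supp_def Ann_def by blast
  have "2 ^ j * rk V' (G j) \<le> card (supp V' \<inter> G j)"
    using dense V' unfolding dense_def by blast
  also have "\<dots> \<le> card ?F" using sub fin(1) by (intro card_mono) auto
  finally have "2 ^ j * rk V' (G j) \<le> card ?F" .
  then have "real (2 ^ j * rk V' (G j)) \<le> real (card ?F)" by (rule of_nat_mono)
  then have *: "real (rk V' (G j)) \<le> real (card ?F) / 2 ^ j" by (simp add: field_simps)
  have "(\<Sum>i\<in>?F. x i) = (\<Sum>i\<in>?F. 1 / 2 ^ j)" using x step.hyps by (intro sum.cong) auto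
  then have F: "(\<Sum>i\<in>?F. x i) = real (card ?F) / 2 ^ j" by simp
  have "G j \<inter> supp V = (G (Suc j) \<inter> supp V) \<union> ?F" using G(2) by blast
  then have "(\<Sum>i\<in>G j \<inter> supp V. x i) = (\<Sum>i\<in>G (Suc j) \<inter> supp V. x i) + (\<Sum>i\<in>?F. x i)"
    using fin by (subst sum.union_disjoint[symmetric]) auto
  moreover have "rk V (G j) = rk V (G (Suc j)) + rk V' (G j)"
    using rk_chain[OF step.prems(1) G(2) G(1)] unfolding V'_def .
  ultimately show ?case using step.IH[OF step.prems] * F by simp
qed

definition wsum :: "(nat \<Rightarrow> real) \<Rightarrow> nat set \<Rightarrow> (nat \<Rightarrow> 'a) \<Rightarrow> real" where
  "wsum x G v = (\<Sum>i\<in>{i\<in>G. v i \<noteq> \<zero>}. x i)"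

text \<open>
  Induction by averaging over the contraction of a coordinate \<open>i\<close>, chosen with probability
  proportional to \<open>x i\<close>: a codeword of weight \<open>H\<close> survives with probability \<open>1 - H / Z\<close>, which
  for \<open>H \<le> Z / 2\<close> is at least \<open>exp (- 2 * H / Z)\<close> and is absorbed by a growth of the inverse
  temperature of order \<open>1 / m\<close>. Summed over \<open>m\<close> this gives the logarithm. The remaining codewords
  are heavy enough for the trivial bound on their number.
\<close>

lemma partition_function_bound:
  fixes x :: "nat \<Rightarrow> real"
  assumes G: "G \<subseteq> {..<n}" and x0: "\<And>i. 0 \<le> x i"
    and W: "\<And>V. subsp V \<Longrightarrow> V \<subseteq> C \<Longrightarrow> real (rk V G) \<le> (\<Sum>i\<in>G \<inter> supp V. x i)"
    and r: "r = real q * exp (- c0 / 2)" "r \<le> 1 / 2" and c0: "0 \<le> c0"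
    and "subsp V" "V \<subseteq> C" "rk V G = m"
  shows "(\<Sum>v\<in>V - Ann V G. exp (- (c0 + 4 * ln (real m + 1)) * wsum x G v))
    \<le> real (card (Ann V G)) * (2 * r * (1 - 1 / 2 ^ m))"
  using assms(7-9)
proof (induction m arbitrary: V)
  case 0
  then show ?case using rk_eq_0[OF _ G] by simp
next
  case (Suc m)
  note V = Suc.prems(1)
  define T where "T = G \<inter> supp V"
  define Z where "Z = (\<Sum>i\<in>T. x i)"
  define c where "c = c0 + 4 * ln (real (Suc m) + 1)"
  define c' where "c' = c0 + 4 * ln (real m + 1)"
  define D where "D = V - Ann V G"
  \<comment> \<open>Bounds the term of any word heavier than \<open>Z / 2\<close>, because
    \<open>Z\<close> is at least the rank \<open>Suc m\<close> and \<open>c\<close> is at least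
    \<open>c0\<close>.\<close>
  define e where "e = exp (- c0 / 2 * real (Suc m))"
  define B where "B = real (card (Ann V G)) * (2 * r * (1 - 1 / 2 ^ m))"
  have Z: "real (Suc m) \<le> Z" using W[OF V Suc.prems(2)] Suc.prems(3) unfolding Z_def T_def by simp
  have r0: "0 \<le> r" unfolding r(1) by simp
  have finT: "finite T" and finV: "finite V" and finD: "finite D"
    using G finite_subset subsp_finite[OF V] unfolding T_def D_def by auto
  have H0: "0 \<le> wsum x G v" for v unfolding wsum_def by (simp add: sum_nonneg x0)
  have ZH: "Z - wsum x G v = (\<Sum>i\<in>T. if v i = \<zero> then x i else 0)" if "v \<in> V" for v
  proof -
    have "{i\<in>G. v i \<noteq> \<zero>} = {i\<in>T. v i \<noteq> \<zero>}" using that G unfolding T_def supp_def by blast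
    then have "wsum x G v = (\<Sum>i\<in>T. if v i \<noteq> \<zero> then x i else 0)"
      unfolding wsum_def using finT by (simp add: sum.inter_filter)
    then show ?thesis unfolding Z_def by (auto simp: sum_subtractf[symmetric] intro!: sum.cong)
  qed
  have HZ: "wsum x G v \<le> Z" if "v \<in> V" for v
  proof -
    have "0 \<le> (\<Sum>i\<in>T. if v i = \<zero> then x i else 0)" by (intro sum_nonneg) (simp add: x0)
    then show ?thesis using ZH[OF that] by linarith
  qed
  have c0c: "c0 \<le> c" unfolding c_def by simp
  \<comment> \<open>The coefficient 4 suffices because 4 / (m + 2) \<ge> 2 / (m + 1).\<close>
  have cc': "2 / Z \<le> c - c'"
  proof -
    have "2 / Z \<le> 2 / real (Suc m)" using Z by (intro divide_left_mono) auto
    also have "\<dots> \<le> 4 * (1 / (real m + 1 + 1))" by (simp add: field_simps)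
    also have "\<dots> \<le> c - c'"
      using inverse_le_ln_quotient[of "real m + 1"] unfolding c_def c'_def by (simp add: algebra_simps)
    finally show ?thesis .
  qed
  have pointwise: "exp (- c * wsum x G v) \<le> e + (Z - wsum x G v) / Z * exp (- c' * wsum x G v)"
    if v: "v \<in> V" for v
  proof (cases "wsum x G v \<le> Z / 2")
    case True
    let ?H = "wsum x G v"
    have "exp (- c * ?H) \<le> exp (- (2 * (?H / Z))) * exp (- c' * ?H)"
    proof -
      have "2 / Z * ?H \<le> (c - c') * ?H" using cc' H0 by (rule mult_right_mono)
      then show ?thesis by (simp add: exp_add[symmetric] algebra_simps)
    qed
    also have "\<dots> \<le> (1 - ?H / Z) * exp (- c' * ?H)"
      using True Z H0 by (intro mult_right_mono one_minus_ge_exp) (auto simp: field_simps)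
    also have "1 - ?H / Z = (Z - ?H) / Z" using Z by (simp add: field_simps)
    finally show ?thesis unfolding e_def by (simp add: add_increasing)
  next
    case False
    have "c0 / 2 * real (Suc m) = c0 * (real (Suc m) / 2)" by simp
    also have "\<dots> \<le> c * wsum x G v" using False Z c0 c0c by (intro mult_mono) auto
    finally have "exp (- c * wsum x G v) \<le> e" unfolding e_def by simp
    then show ?thesis using HZ[OF v] Z by (simp add: add_increasing2)
  qed
  \<comment> \<open>Contracting a support coordinate in \<open>G\<close> lowers the rank to
    \<open>m\<close> and keeps the annihilator of \<open>G\<close>, so the induction hypothesis
    applies.\<close>
  have contract: "(\<Sum>v\<in>{v\<in>D. v i = \<zero>}. exp (- c' * wsum x G v)) \<le> B" if i: "i \<in> T" for i
  proof -
    have iG: "i \<in> G" "i < n" "i \<in> supp V" using i G unfolding T_def by auto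
    have A: "subsp (Ann V {i})" using subsp_Ann[OF V] iG by simp
    have AG: "Ann (Ann V {i}) G = Ann V G" using Ann_Ann iG by simp
    have "rk V {i} = 1" using rk_insert[OF V _ iG(2), of "{}"] iG(3) by (simp add: rk_empty Ann_empty)
    then have "rk (Ann V {i}) G = m" using rk_chain[OF V _ G, of "{i}"] iG Suc.prems(3) by simp
    moreover have "Ann V {i} \<subseteq> C" using Ann_subset Suc.prems(2) by blast
    moreover have "{v\<in>D. v i = \<zero>} = Ann V {i} - Ann (Ann V {i}) G"
      unfolding AG D_def by (auto simp: Ann_def)
    ultimately show ?thesis using Suc.IH[OF A] unfolding AG B_def c'_def by simp
  qed
  \<comment> \<open>\<open>Z - wsum x G v\<close> is the total weight of the coordinates of
    \<open>T\<close> at which \<open>v\<close> vanishes; exchanging the sums averages over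
    contractions.\<close>
  have "(\<Sum>v\<in>D. (Z - wsum x G v) * exp (- c' * wsum x G v))
      = (\<Sum>v\<in>D. \<Sum>i\<in>T. if v i = \<zero> then x i * exp (- c' * wsum x G v) else 0)"
    by (intro sum.cong refl) (auto simp: D_def ZH sum_distrib_right intro!: sum.cong)
  also have "\<dots> = (\<Sum>i\<in>T. x i * (\<Sum>v\<in>{v\<in>D. v i = \<zero>}. exp (- c' * wsum x G v)))"
    by (subst sum.swap) (auto simp: sum_distrib_left sum.inter_filter finD intro!: sum.cong)
  also have "\<dots> \<le> (\<Sum>i\<in>T. x i * B)" using contract x0 by (intro sum_mono mult_left_mono) auto
  also have "\<dots> = Z * B" unfolding Z_def by (simp add: sum_distrib_right)
  finally have avg: "(\<Sum>v\<in>D. (Z - wsum x G v) / Z * exp (- c' * wsum x G v)) \<le> B"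
    using Z by (simp add: sum_divide_distrib[symmetric] field_simps)
  have "card D \<le> card V" using finV unfolding D_def by (intro card_mono) auto
  then have "real (card D) * e \<le> real (card V) * e" unfolding e_def by (intro mult_right_mono) auto
  \<comment> \<open>\<open>V\<close> has \<open>q ^ Suc m\<close> words per word of
    \<open>Ann V G\<close>, and each factor \<open>q\<close> meets one factor
    \<open>exp (- c0 / 2)\<close> of \<open>e\<close>.\<close>
  also have "\<dots> = real (card (Ann V G)) * r ^ Suc m"
    unfolding card_eq_rk[OF V G] Suc.prems(3) e_def r(1) exp_of_nat2_mult
    by (simp add: power_mult_distrib algebra_simps)
  also have "\<dots> \<le> real (card (Ann V G)) * (r / 2 ^ m)"
  proof -
    have "r ^ m \<le> (1 / 2) ^ m" using r0 r(2) by (rule power_mono[rotated])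
    then have "r * r ^ m \<le> r * (1 / 2) ^ m" using r0 by (rule mult_left_mono)
    then show ?thesis by (intro mult_left_mono) (auto simp: power_divide)
  qed
  finally have bulk: "real (card D) * e \<le> real (card (Ann V G)) * (r / 2 ^ m)" .
  have "(\<Sum>v\<in>D. exp (- c * wsum x G v))
      \<le> (\<Sum>v\<in>D. e + (Z - wsum x G v) / Z * exp (- c' * wsum x G v))"
    using pointwise by (intro sum_mono) (auto simp: D_def)
  also have "\<dots> = real (card D) * e + (\<Sum>v\<in>D. (Z - wsum x G v) / Z * exp (- c' * wsum x G v))"
    by (simp add: sum.distrib)
  also have "\<dots> \<le> real (card (Ann V G)) * (r / 2 ^ m) + B" using bulk avg by (rule add_mono)
  also have "\<dots> = real (card (Ann V G)) * (2 * r * (1 - 1 / 2 ^ Suc m))"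
    unfolding B_def by (simp add: field_simps)
  finally show ?case unfolding D_def c_def by simp
qed

section \<open>The sparsifier\<close>

text \<open>
  Codewords are counted with weight \<open>1 / card (Ann C G)\<close> instead of being restricted to \<open>G\<close>;
  a failure at one codeword then has total weight at least one.
\<close>

lemma Ann_translates_le:
  assumes C: "subsp C" and G: "G \<subseteq> {..<n}" and v: "v \<in> C"
    and D: "\<And>v'. v' \<in> C \<Longrightarrow> (\<And>i. i \<in> G \<Longrightarrow> v' i = v i) \<Longrightarrow> v' \<in> D" and "finite D"
  shows "card (Ann C G) \<le> card D"
proof (rule card_inj_on_le)
  have car: "u i \<in> carrier R" if "u \<in> Ann C G" "i < n" for u i
    using that Ann_subset subsp_carrier[OF C] by blast
  have vc: "v i \<in> carrier R" if "i < n" for i using subsp_carrier[OF C v that] .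
  \<comment> \<open>The translates of \<open>v\<close> by \<open>Ann C G\<close> are distinct
    codewords agreeing with \<open>v\<close> on \<open>G\<close>.\<close>
  show "inj_on (\<lambda>u. axpy \<one> u v) (Ann C G)"
  proof (rule inj_onI)
    fix u u' assume u: "u \<in> Ann C G" "u' \<in> Ann C G" and eq: "axpy \<one> u v = axpy \<one> u' v"
    show "u = u'"
    proof (rule subsp_ext[OF subsp_Ann[OF C G] u])
      fix i assume "i < n"
      then show "u i = u' i" using fun_cong[OF eq, of i] car[OF u(1)] car[OF u(2)] vc by (simp add: axpy_def)
    qed
  qed
  show "(\<lambda>u. axpy \<one> u v) ` Ann C G \<subseteq> D"
  proof (rule image_subsetI, rule D)
    fix u assume u: "u \<in> Ann C G"
    then show "axpy \<one> u v \<in> C" using subsp_axpy[OF C _ _ v] Ann_subset by blast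
    fix i assume "i \<in> G"
    then have "i < n" "u i = \<zero>" using G u unfolding Ann_def by auto
    then show "axpy \<one> u v i = v i" using vc by (simp add: axpy_def)
  qed
qed fact

text \<open>The size is \<open>2 * K\<close>, where \<open>K\<close> is
  \<open>rho = 4 * c / eps\<^sup>2\<close> times a bound \<open>2 * dm C * J\<close> on the total
  importance. In \<open>c\<close> the first term pays for the union over \<open>J\<close> levels,
  the second for counting codewords at rank up to \<open>dm C\<close>.\<close>

lemma sparsifier_of_subspace:
  assumes C: "subsp C" and dm: "0 < dm C" and J: "n < 2 ^ J" "0 < J" and eps: "0 < eps" "eps < 1"
    and c: "c = 2 * ln (16 * real J * real q) + 4 * ln (real (dm C) + 1)"
  shows "has_sparsifier R n C eps (16 * c * real (dm C) * real J / eps\<^sup>2)"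
proof -
  obtain G :: "nat \<Rightarrow> nat set" where G0: "G 0 = {..<n}" and G: "\<And>j. G j \<subseteq> {..<n}" "\<And>j. G (Suc j) \<subseteq> G j"
    and dense: "\<And>j. dense C (2 ^ j) (G j)" and card_G: "\<And>j. card (G j - G (Suc j)) \<le> 2 ^ Suc j * dm C"
    using dense_chain[OF C] by blast
  have finG: "finite (G j)" for j using G(1) finite_subset by blast
  have anti: "G j' \<subseteq> G j" if "j \<le> j'" for j j' using lift_Suc_antimono_le[of G, OF G(2) that] .
  \<comment> \<open>Positive rank on \<open>G J\<close> would require \<open>2 ^ J\<close> >
    \<open>n\<close> coordinates.\<close>
  have GJ: "Ann C (G J) = C"
  proof (rule rk_eq_0[OF C G(1)], rule ccontr)
    assume "rk C (G J) \<noteq> 0"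
    then have "2 ^ J * 1 \<le> 2 ^ J * rk C (G J)" by (intro mult_le_mono2) simp
    also have "\<dots> \<le> card (supp C \<inter> G J)" using dense C unfolding dense_def by blast
    also have "\<dots> \<le> card {..<n}" using G(1) by (intro card_mono) auto
    finally show False using J by simp
  qed
  \<comment> \<open>The last level containing \<open>i\<close>, consulted only for \<open>i\<close>
    outside \<open>G J\<close>.\<close>
  define lev where "lev i = (LEAST j. i \<notin> G (Suc j))" for i
  have lev: "i \<in> G j \<longleftrightarrow> j \<le> lev i" if i: "i < n" "i \<notin> G J" for i j
  proof -
    have "i \<notin> G (Suc (J - 1))" using i(2) J(2) by simp
    then have 1: "i \<notin> G (Suc (lev i))" unfolding lev_def by (rule LeastI)
    have "i \<in> G (lev i)"
    proof (cases "lev i")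
      case 0
      then show ?thesis using G0 i by simp
    next
      case (Suc l)
      then show ?thesis using not_less_Least[of l "\<lambda>j. i \<notin> G (Suc j)"] unfolding lev_def by auto
    qed
    then show ?thesis using 1 anti[of j "lev i"] anti[of "Suc (lev i)" j] by (meson not_less_eq_eq subsetD)
  qed
  \<comment> \<open>Coordinates in \<open>G J\<close> get importance 0, since every codeword
    vanishes there.\<close>
  define x :: "nat \<Rightarrow> real" where "x i = (if i < n \<and> i \<notin> G J then 1 / 2 ^ lev i else 0)" for i
  have x0: "0 \<le> x i" for i unfolding x_def by simp
  have x: "x i = 1 / 2 ^ j" if "j < J" "i \<in> G j - G (Suc j)" for i j
  proof -
    have i: "i < n" "i \<notin> G J" using that G(1) anti[of "Suc j" J] by auto
    then have "lev i = j" using lev[OF i, of j] lev[OF i, of "Suc j"] that by auto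
    then show ?thesis using i unfolding x_def by simp
  qed
  note level_weight = level_weight_ge_rk[OF C G dense GJ x x0]
  \<comment> \<open>Each layer has at most \<open>2 ^ Suc m * dm C\<close> coordinates of importance
    \<open>1 / 2 ^ m\<close>, a total of at most \<open>2 * dm C\<close>.\<close>
  have x_sum: "(\<Sum>i\<in>{..<n} - G m. x i) \<le> 2 * real (dm C) * real m" if "m \<le> J" for m
    using that
  proof (induction m)
    case 0
    then show ?case using G0 by simp
  next
    case (Suc m)
    have "{..<n} - G (Suc m) = ({..<n} - G m) \<union> (G m - G (Suc m))" using G by blast
    then have "(\<Sum>i\<in>{..<n} - G (Suc m). x i) = (\<Sum>i\<in>{..<n} - G m. x i) + (\<Sum>i\<in>G m - G (Suc m). x i)"
      using finG by (subst sum.union_disjoint[symmetric]) auto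
    moreover have "(\<Sum>i\<in>G m - G (Suc m). x i) = (\<Sum>i\<in>G m - G (Suc m). 1 / 2 ^ m)"
      using x Suc.prems by (intro sum.cong) auto
    moreover have "real (card (G m - G (Suc m))) / 2 ^ m \<le> 2 * real (dm C)"
    proof -
      have "real (card (G m - G (Suc m))) \<le> real (2 ^ Suc m * dm C)" using card_G by (rule of_nat_mono)
      then show ?thesis by (simp add: field_simps)
    qed
    ultimately show ?case using Suc by (simp add: algebra_simps)
  qed
  have x_total: "(\<Sum>i\<in>{..<n}. x i) \<le> 2 * real (dm C) * real J"
  proof -
    have "(\<Sum>i\<in>{..<n}. x i) = (\<Sum>i\<in>{..<n} - G J. x i)" by (intro sum.mono_neutral_right) (auto simp: x_def)
    then show ?thesis using x_sum by simp
  qed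
  \<comment> \<open>Chosen to give \<open>r = 1 / (16 * real J)\<close>, so that \<open>J\<close>
    levels of failure cost at most \<open>2 * r\<close> sum to at most 1/8.\<close>
  define c0 where "c0 = 2 * ln (16 * real J * real q)"
  define r where "r = real q * exp (- c0 / 2)"
  have Jq: "1 \<le> real J" "2 \<le> real q" using J(2) q_ge_2 by auto
  have Jq1: "1 * 1 \<le> 16 * real J * real q" using Jq by (intro mult_mono) auto
  have c0: "0 \<le> c0" using Jq1 unfolding c0_def by simp
  have r: "r = 1 / (16 * real J)"
  proof -
    have "exp (- c0 / 2) = 1 / (16 * real J * real q)" using Jq1 unfolding c0_def by (simp add: exp_minus field_simps)
    then show ?thesis using Jq unfolding r_def by simp
  qed
  have r2: "r \<le> 1 / 2" using Jq unfolding r by (simp add: field_simps)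
  have c_pos: "0 < c"
    using c0 dm unfolding c c0_def[symmetric] by (simp add: add_nonneg_pos)
  \<comment> \<open>Makes the Chernoff exponent \<open>rho * eps\<^sup>2 / 4\<close> equal to the
    inverse temperature \<open>c\<close>.\<close>
  define rho where "rho = 4 * c / eps\<^sup>2"
  have rho: "0 < rho" using c_pos eps unfolding rho_def by simp
  have rho_eps: "rho * eps\<^sup>2 / 4 = c" using eps unfolding rho_def by simp
  define K where "K = rho * (2 * real (dm C) * real J)"
  have K: "rho * (\<Sum>i\<in>{..<n}. x i) \<le> K" "0 < K"
    using x_total rho dm J(2) unfolding K_def by auto
  define T where "T = Sigma {..<J} (\<lambda>j. C - Ann C (G j))"
  define B where "B = (\<lambda>(j, v). {i\<in>G j. v i \<noteq> \<zero>})"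
  define b :: "nat \<times> (nat \<Rightarrow> 'a) \<Rightarrow> real" where "b = (\<lambda>(j, v). 1 / real (card (Ann C (G j))))"
  have finT: "finite T" unfolding T_def using subsp_finite[OF C] by auto
  have BG: "B t \<subseteq> {..<n}" for t using G(1) unfolding B_def by (auto split: prod.splits)
  have b0: "0 \<le> b t" for t unfolding b_def by (simp split: prod.splits)
  have card_Ann: "0 < card (Ann C (G j))" for j using card_subsp_pos[OF subsp_Ann[OF C G(1)]] .
  have level_sum: "(\<Sum>v\<in>C - Ann C (G j). b (j, v) * exp (- c * (\<Sum>i\<in>B (j, v). x i))) \<le> 2 * r"
    if j: "j < J" for j
  proof -
    define m where "m = rk C (G j)"
    have m: "m \<le> dm C" unfolding m_def by (rule rk_le_dm)
    have H0: "0 \<le> wsum x (G j) v" for v unfolding wsum_def by (simp add: sum_nonneg x0)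
    have "(\<Sum>v\<in>C - Ann C (G j). b (j, v) * exp (- c * (\<Sum>i\<in>B (j, v). x i)))
        = 1 / real (card (Ann C (G j))) * (\<Sum>v\<in>C - Ann C (G j). exp (- c * wsum x (G j) v))"
      unfolding b_def B_def wsum_def by (simp add: sum_distrib_left)
    also have "\<dots> \<le> 1 / real (card (Ann C (G j))) *
        (\<Sum>v\<in>C - Ann C (G j). exp (- (c0 + 4 * ln (real m + 1)) * wsum x (G j) v))"
    proof (intro mult_left_mono sum_mono)
      fix v
      have "- c \<le> - (c0 + 4 * ln (real m + 1))" using m unfolding c c0_def by simp
      then have "- c * wsum x (G j) v \<le> - (c0 + 4 * ln (real m + 1)) * wsum x (G j) v"
        using H0 by (rule mult_right_mono)
      then show "exp (- c * wsum x (G j) v) \<le> exp (- (c0 + 4 * ln (real m + 1)) * wsum x (G j) v)"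
        by (simp only: exp_le_cancel_iff)
    qed simp
    also have "\<dots> \<le> 1 / real (card (Ann C (G j))) * (real (card (Ann C (G j))) * (2 * r * (1 - 1 / 2 ^ m)))"
    proof (intro mult_left_mono)
      show "(\<Sum>v\<in>C - Ann C (G j). exp (- (c0 + 4 * ln (real m + 1)) * wsum x (G j) v))
          \<le> real (card (Ann C (G j))) * (2 * r * (1 - 1 / 2 ^ m))"
        by (rule partition_function_bound[where C = C])
          (use G(1) x0 level_weight j r2 c0 C in \<open>auto simp: r_def m_def\<close>)
    qed simp
    also have "\<dots> = 2 * r * (1 - 1 / 2 ^ m)" using card_Ann[of j] by simp
    also have "\<dots> \<le> 2 * r" by (rule mult_left_le) (auto simp: r)
    finally show ?thesis .
  qed
  have small: "(\<Sum>t\<in>T. b t * exp (- (rho * eps\<^sup>2 / 4) * (\<Sum>i\<in>B t. x i))) < 1 / 4"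
  proof -
    have "(\<Sum>t\<in>T. b t * exp (- c * (\<Sum>i\<in>B t. x i)))
        = (\<Sum>j<J. \<Sum>v\<in>C - Ann C (G j). b (j, v) * exp (- c * (\<Sum>i\<in>B (j, v). x i)))"
      unfolding T_def using subsp_finite[OF C] by (subst sum.Sigma) (auto simp: case_prod_beta)
    also have "\<dots> \<le> (\<Sum>j<J. 2 * r)" using level_sum by (intro sum_mono) simp
    also have "\<dots> < 1 / 4" using Jq unfolding r by simp
    finally show ?thesis unfolding rho_eps .
  qed
  obtain S w where S: "S \<subseteq> {..<n}" "\<And>i. 0 \<le> w i" "real (card S) \<le> 2 * K"
    and bad: "(\<Sum>t\<in>{t\<in>T. eps * (\<Sum>i\<in>B t. x i) < \<bar>sampling_error x w S (B t)\<bar>}. b t) < 1"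
    using importance_sampling[OF _ finT BG x0 rho eps(1) less_imp_le[OF eps(2)] b0 small K] by blast
  have good: "\<bar>sampling_error x w S (B (j, v))\<bar> \<le> eps * (\<Sum>i\<in>B (j, v). x i)"
    if j: "j < J" and v: "v \<in> C" for j v
  proof (rule ccontr)
    assume "\<not> ?thesis"
    then have lt: "eps * (\<Sum>i\<in>B (j, v). x i) < \<bar>sampling_error x w S (B (j, v))\<bar>" by simp
    define D where "D = {v'\<in>C. B (j, v') = B (j, v)}"
    \<comment> \<open>An empty set has no sampling error; hence the words of \<open>D\<close> do not
      vanish on \<open>G j\<close>, and the pairs \<open>(j, v')\<close> belong to
      \<open>T\<close>.\<close>
    have "B (j, v) \<noteq> {}" using lt by (auto simp: sampling_error_def)
    then have sub: "Pair j ` D \<subseteq> {t\<in>T. eps * (\<Sum>i\<in>B t. x i) < \<bar>sampling_error x w S (B t)\<bar>}"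
      using lt j unfolding T_def D_def by (auto simp: B_def Ann_def)
    have finD: "finite D" using subsp_finite[OF C] unfolding D_def by simp
    have "card (Ann C (G j)) \<le> card D"
      by (rule Ann_translates_le[OF C G(1) v _ finD]) (auto simp: D_def B_def)
    then have "1 \<le> real (card D) * (1 / real (card (Ann C (G j))))" using card_Ann[of j] by simp
    also have "\<dots> = (\<Sum>t\<in>Pair j ` D. b t)" by (simp add: sum.reindex inj_on_def b_def)
    also have "\<dots> \<le> (\<Sum>t\<in>{t\<in>T. eps * (\<Sum>i\<in>B t. x i) < \<bar>sampling_error x w S (B t)\<bar>}. b t)"
      using finT b0 sub by (intro sum_mono2) auto
    finally show False using bad by simp
  qed
  \<comment> \<open>With these coefficients the levels \<open>j \<le> lev i\<close> that contain \<open>i\<close> contribute \<open>2 ^ lev i * x i = 1\<close>.\<close>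
  define a :: "nat \<Rightarrow> real" where "a j = (if j = 0 then 1 else 2 ^ (j - 1))" for j
  have a0: "0 \<le> a j" for j unfolding a_def by simp
  have a_sum: "(\<Sum>j\<le>l. a j) = 2 ^ l" for l by (induction l) (auto simp: a_def)
  have telescope: "(\<Sum>j<J. a j * (\<Sum>i\<in>B (j, v). x i * f i)) = (\<Sum>i\<in>{i\<in>{..<n}. v i \<noteq> \<zero>}. f i)"
    if v: "v \<in> C" for v f
  proof -
    let ?P = "{i\<in>{..<n}. v i \<noteq> \<zero>}"
    have "a j * (\<Sum>i\<in>B (j, v). x i * f i) = (\<Sum>i\<in>?P. if i \<in> G j then a j * x i * f i else 0)" for j
    proof -
      have "B (j, v) = {i\<in>?P. i \<in> G j}" using G(1) unfolding B_def by auto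
      moreover have "(\<Sum>i\<in>?P. if i \<in> G j then a j * x i * f i else 0)
          = (\<Sum>i\<in>{i\<in>?P. i \<in> G j}. a j * x i * f i)" by (rule sum.inter_filter[symmetric]) simp
      moreover have "a j * (\<Sum>i\<in>B (j, v). x i * f i) = (\<Sum>i\<in>B (j, v). a j * x i * f i)"
        by (simp only: sum_distrib_left mult.assoc)
      ultimately show ?thesis by (simp only:)
    qed
    then have "(\<Sum>j<J. a j * (\<Sum>i\<in>B (j, v). x i * f i))
        = (\<Sum>j<J. \<Sum>i\<in>?P. if i \<in> G j then a j * x i * f i else 0)"
      by (simp only:)
    also have "\<dots> = (\<Sum>i\<in>?P. \<Sum>j<J. if i \<in> G j then a j * x i * f i else 0)" by (rule sum.swap)
    also have "\<dots> = (\<Sum>i\<in>?P. f i)"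
    proof (rule sum.cong[OF refl])
      fix i assume i: "i \<in> ?P"
      moreover have "v \<in> Ann C (G J)" using v GJ by simp
      ultimately have iJ: "i < n" "i \<notin> G J" unfolding Ann_def by auto
      have "\<not> J \<le> lev i" using lev[OF iJ, of J] iJ(2) by simp
      then have "j < J \<and> i \<in> G j \<longleftrightarrow> j \<le> lev i" for j using lev[OF iJ, of j] by linarith
      then have "{j\<in>{..<J}. i \<in> G j} = {..lev i}" by (simp add: atMost_def)
      moreover have "(\<Sum>j<J. if i \<in> G j then a j * x i * f i else 0)
          = (\<Sum>j\<in>{j\<in>{..<J}. i \<in> G j}. a j * x i * f i)" by (rule sum.inter_filter[symmetric]) simp
      ultimately have "(\<Sum>j<J. if i \<in> G j then a j * x i * f i else 0) = (\<Sum>j\<le>lev i. a j * x i * f i)"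
        by (simp only:)
      also have "\<dots> = (\<Sum>j\<le>lev i. a j) * x i * f i" by (simp add: sum_distrib_right)
      also have "\<dots> = f i" using iJ by (simp add: a_sum x_def)
      finally show "(\<Sum>j<J. if i \<in> G j then a j * x i * f i else 0) = f i" .
    qed
    finally show ?thesis .
  qed
  \<comment> \<open>The summation identity is used twice: with \<open>f\<close> the sampling
    deviation it expresses the error in Hamming weight through the level errors, and with
    \<open>f\<close> = 1 it recombines their bounds into \<open>eps * wt R n v\<close>.\<close>
  have approx: "\<bar>(\<Sum>i\<in>{i\<in>S. v i \<noteq> \<zero>}. w i) - real (wt R n v)\<bar> \<le> eps * real (wt R n v)" if v: "v \<in> C" for v
  proof -
    let ?P = "{i\<in>{..<n}. v i \<noteq> \<zero>}"
    have "?P \<inter> {i. i \<in> S} = {i\<in>S. v i \<noteq> \<zero>}" using S(1) by auto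
    then have "(\<Sum>i\<in>{i\<in>S. v i \<noteq> \<zero>}. w i) - real (wt R n v) = (\<Sum>i\<in>?P. (if i \<in> S then w i else 0) - 1)"
      by (simp add: sum_subtractf sum.If_cases wt_def)
    also have "\<dots> = (\<Sum>j<J. a j * sampling_error x w S (B (j, v)))"
      unfolding sampling_error_def telescope[OF v] ..
    finally have "\<bar>(\<Sum>i\<in>{i\<in>S. v i \<noteq> \<zero>}. w i) - real (wt R n v)\<bar>
        \<le> (\<Sum>j<J. \<bar>a j * sampling_error x w S (B (j, v))\<bar>)" by (simp add: sum_abs)
    also have "\<dots> \<le> (\<Sum>j<J. eps * (a j * (\<Sum>i\<in>B (j, v). x i * 1)))"
    proof (rule sum_mono)
      fix j assume "j \<in> {..<J}"
      then have "a j * \<bar>sampling_error x w S (B (j, v))\<bar> \<le> a j * (eps * (\<Sum>i\<in>B (j, v). x i))"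
        using good[OF _ v] a0 by (intro mult_left_mono) auto
      then show "\<bar>a j * sampling_error x w S (B (j, v))\<bar> \<le> eps * (a j * (\<Sum>i\<in>B (j, v). x i * 1))"
        using a0 by (simp add: abs_mult mult.left_commute)
    qed
    also have "\<dots> = eps * (\<Sum>i\<in>?P. 1)" unfolding sum_distrib_left[symmetric] telescope[OF v] ..
    finally show ?thesis unfolding wt_def by simp
  qed
  have "2 * K = 16 * c * real (dm C) * real J / eps\<^sup>2" unfolding K_def rho_def by simp
  then have card_S: "real (card S) \<le> 16 * c * real (dm C) * real J / eps\<^sup>2" using S(3) by simp
  show ?thesis unfolding has_sparsifier_def
  proof (intro exI conjI ballI)
    fix v assume "v \<in> C"
    note approx = approx[OF this]
    show "(1 - eps) * real (wt R n v) \<le> (\<Sum>i\<in>{i\<in>S. v i \<noteq> \<zero>}. w i)"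
      using approx unfolding left_diff_distrib by linarith
    show "(\<Sum>i\<in>{i\<in>S. v i \<noteq> \<zero>}. w i) \<le> (1 + eps) * real (wt R n v)"
      using approx unfolding distrib_right by linarith
  qed (use S card_S in simp_all)
qed

section \<open>Linear codes as subspaces\<close>

text \<open>Closure is inherited from the coefficient vectors, and injectivity of the encoding gives
  \<open>q ^ k\<close> words, hence dimension \<open>k\<close>.\<close>

lemma linear_code_subsp:
  assumes "linear_code R n k C"
  shows "subsp C" and "dm C = k"
proof -
  obtain g where g: "\<And>j. j < k \<Longrightarrow> g j \<in> vecs R n"
    and inj: "inj_on (lincomb R n k g) ({..<k} \<rightarrow>\<^sub>E carrier R)"
    and C: "C = lincomb R n k g ` ({..<k} \<rightarrow>\<^sub>E carrier R)"
    using assms unfolding linear_code_def by blast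
  have gc: "g j i \<in> carrier R" if "j < k" "i < n" for i j
    using g[OF that(1)] that(2) unfolding vecs_def by (auto simp: PiE_def Pi_def)
  have "(\<lambda>i\<in>{..<n}. \<zero>) = lincomb R n k g (\<lambda>j\<in>{..<k}. \<zero>)"
  proof
    fix i
    have "finsum R (\<lambda>j. (\<lambda>j\<in>{..<k}. \<zero>) j \<otimes> g j i) {..<k} = finsum R (\<lambda>j. \<zero>) {..<k}" if "i < n"
      using gc that by (intro finsum_cong') auto
    then show "(\<lambda>i\<in>{..<n}. \<zero>) i = lincomb R n k g (\<lambda>j\<in>{..<k}. \<zero>) i"
      unfolding lincomb_def by (simp add: finsum_zero)
  qed
  moreover have "(\<lambda>j\<in>{..<k}. \<zero>) \<in> {..<k} \<rightarrow>\<^sub>E carrier R" by simp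
  ultimately have zero: "(\<lambda>i\<in>{..<n}. \<zero>) \<in> C" unfolding C by (rule image_eqI)
  have lin: "axpy c (lincomb R n k g u) (lincomb R n k g v) \<in> C"
    if c: "c \<in> carrier R" and u: "u \<in> {..<k} \<rightarrow>\<^sub>E carrier R" and v: "v \<in> {..<k} \<rightarrow>\<^sub>E carrier R" for c u v
  proof -
    define d where "d = (\<lambda>j\<in>{..<k}. c \<otimes> u j \<oplus> v j)"
    have uc: "u j \<in> carrier R" "v j \<in> carrier R" if "j < k" for j using that u v by auto
    have "axpy c (lincomb R n k g u) (lincomb R n k g v) = lincomb R n k g d"
    proof
      fix i
      have "c \<otimes> finsum R (\<lambda>j. u j \<otimes> g j i) {..<k} \<oplus> finsum R (\<lambda>j. v j \<otimes> g j i) {..<k}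
          = finsum R (\<lambda>j. d j \<otimes> g j i) {..<k}" if i: "i < n"
      proof -
        have "c \<otimes> finsum R (\<lambda>j. u j \<otimes> g j i) {..<k} \<oplus> finsum R (\<lambda>j. v j \<otimes> g j i) {..<k}
            = finsum R (\<lambda>j. c \<otimes> (u j \<otimes> g j i)) {..<k} \<oplus> finsum R (\<lambda>j. v j \<otimes> g j i) {..<k}"
          using c uc gc i by (subst finsum_rdistr) auto
        also have "\<dots> = finsum R (\<lambda>j. c \<otimes> (u j \<otimes> g j i) \<oplus> v j \<otimes> g j i) {..<k}"
          using c uc gc i by (subst finsum_addf) auto
        also have "\<dots> = finsum R (\<lambda>j. d j \<otimes> g j i) {..<k}"
          using c uc gc i by (intro finsum_cong') (auto simp: d_def l_distr m_assoc)
        finally show ?thesis .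
      qed
      then show "axpy c (lincomb R n k g u) (lincomb R n k g v) i = lincomb R n k g d i"
        unfolding axpy_def lincomb_def by simp
    qed
    moreover have "d \<in> {..<k} \<rightarrow>\<^sub>E carrier R" unfolding d_def using c uc by auto
    ultimately show ?thesis unfolding C by blast
  qed
  have "lincomb R n k g u \<in> vecs R n" if u: "u \<in> {..<k} \<rightarrow>\<^sub>E carrier R" for u
  proof -
    have "finsum R (\<lambda>j. u j \<otimes> g j i) {..<k} \<in> carrier R" if "i < n" for i
      using u gc that by (intro finsum_closed) auto
    then show ?thesis unfolding lincomb_def vecs_def by auto
  qed
  then show "subsp C" using zero lin unfolding subsp_def by (auto simp: C)
  have "card C = card ({..<k} \<rightarrow>\<^sub>E carrier R)" unfolding C by (rule card_image[OF inj])
  then show "dm C = k" by (intro dm_eqI) (simp add: card_PiE)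
qed

end

section \<open>Choice of parameters and final bound\<close>

lemma has_sparsifier_mono:
  "has_sparsifier R n C eps s \<Longrightarrow> s \<le> s' \<Longrightarrow> has_sparsifier R n C eps s'"
  unfolding has_sparsifier_def
  by (elim exE, rename_tac S w, rule_tac x = S in exI, rule_tac x = w in exI) auto

text \<open>The bound on \<open>J\<close> and \<open>log 2 k\<close> \<le> \<open>k\<close> give
  \<open>16 * J * q\<close> \<le> \<open>32 * a * k * q\<close>. The resulting sum of logarithms is
  absorbed into the product \<open>log 2 k * log 2 q\<close>, using (Lk - 1)(Lq - 1) \<ge>
  0.\<close>

lemma log_budget:
  fixes a k q J :: real
  assumes a: "1 \<le> a" and k: "4 \<le> k" and q: "2 \<le> q" and J: "1 \<le> J" "J \<le> 2 * a * log 2 k"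
  shows "2 * ln (16 * J * q) + 4 * ln (k + 1) \<le> (2 * log 2 (32 * a) + 12) * (log 2 k * log 2 q)"
proof -
  define Lk where "Lk = log 2 k"
  define Lq where "Lq = log 2 q"
  define La where "La = log 2 (32 * a)"
  have ln_le: "ln y \<le> log 2 y" if "1 \<le> y" for y :: real
  proof -
    have "ln y * ln 2 \<le> ln y * 1" using that ln_2_less_1 by (intro mult_left_mono) auto
    then show ?thesis by (simp add: log_def field_simps)
  qed
  have Lk: "2 \<le> Lk" unfolding Lk_def using k by (simp add: le_log_iff)
  have Lq: "1 \<le> Lq" unfolding Lq_def using q by simp
  have La: "0 \<le> La" unfolding La_def using a by simp
  have "Lk \<le> k"
  proof -
    have "1 / 2 \<le> ln (2::real)" using ln_le_minus_one[of "1 / 2 :: real"] by (simp add: ln_div)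
    then have "k * (1 / 2) \<le> k * ln 2" using k by (intro mult_left_mono) auto
    moreover have "ln (k / 2) \<le> k / 2 - 1" using k by (intro ln_le_minus_one) simp
    moreover have "ln (k / 2) = ln k - ln 2" using k by (simp add: ln_div)
    ultimately have "ln k \<le> k * ln 2" using ln_2_less_1 by linarith
    then show ?thesis unfolding Lk_def by (simp add: log_def field_simps)
  qed
  then have "2 * a * Lk \<le> 2 * a * k" using a by (intro mult_left_mono) auto
  then have "J \<le> 2 * a * k" using J(2) unfolding Lk_def by linarith
  then have "16 * J * q \<le> 16 * (2 * a * k) * q" using q by (intro mult_right_mono mult_left_mono) auto
  moreover have "1 * 1 \<le> 16 * J * q" using J q by (intro mult_mono) auto
  ultimately have "log 2 (16 * J * q) \<le> log 2 (32 * a * k * q)" and "ln (16 * J * q) \<le> log 2 (16 * J * q)"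
    by (auto intro!: log_mono ln_le simp: mult.assoc)
  then have "ln (16 * J * q) \<le> log 2 (32 * a * k * q)" by linarith
  also have "\<dots> = La + Lk + Lq" unfolding La_def Lk_def Lq_def using a k q by (simp add: log_mult)
  finally have 1: "ln (16 * J * q) \<le> La + Lk + Lq" .
  have "k + 1 \<le> k * 2" using k by simp
  then have "log 2 (k + 1) \<le> log 2 (k * 2)" using k by (intro log_mono) auto
  then have "ln (k + 1) \<le> log 2 (k * 2)" using ln_le[of "k + 1"] k by linarith
  also have "\<dots> = Lk + 1" unfolding Lk_def using k by (simp add: log_mult)
  finally have 2: "ln (k + 1) \<le> Lk + 1" .
  have "0 \<le> (Lk - 1) * (Lq - 1)" using Lk Lq by simp
  then have 3: "Lk + Lq \<le> Lk * Lq + 1" by (simp add: algebra_simps)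
  have 4: "2 \<le> Lk * Lq" using Lk Lq mult_mono[of 2 Lk 1 Lq] by simp
  have 5: "Lk \<le> Lk * Lq" using Lk Lq by simp
  have 6: "La \<le> La * (Lk * Lq)" using La 4 by (simp add: mult_le_cancel_left1)
  show ?thesis using 1 2 3 4 5 6 unfolding Lk_def[symmetric] Lq_def[symmetric] La_def[symmetric]
    by (simp add: algebra_simps)
qed

theorem theorem4p7:
  fixes a :: real
  assumes "a \<ge> 1"
  shows "\<exists>Ca::real. \<forall>(R :: 'a ring) (n::nat) (k::nat) (eps::real) C.
    field R \<and> finite (carrier R) \<and> k \<ge> 4 \<and> 0 < eps \<and> eps < 1 \<and>
    real n \<le> real k powr a \<and> linear_code R n k C \<longrightarrow>
    has_sparsifier R n C eps
      (Ca * real k * (log 2 (real k))\<^sup>2 * log 2 (real (card (carrier R)))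
         * (log 2 (log 2 (real k)))\<^sup>2 / eps\<^sup>2)"
proof (intro exI allI impI, elim conjE)
  fix R :: "'a ring" and n k :: nat and eps :: real and C
  assume R: "field R" "finite (carrier R)" and k: "4 \<le> k" and eps: "0 < eps" "eps < 1"
    and n: "real n \<le> real k powr a" and code: "linear_code R n k C"
  interpret coordinate_space R n
    using R by (simp add: coordinate_space_def coordinate_space_axioms_def)
  define Lk where "Lk = log 2 (real k)"
  define Lq where "Lq = log 2 (real q)"
  define A where "A = 2 * log 2 (32 * a) + 12"
  \<comment> \<open>Since \<open>n\<close> \<le> \<open>k powr a\<close> =
    \<open>2 powr (a * Lk)\<close>, the added 1 makes \<open>n < 2 ^ J\<close> strict.\<close>
  define J where "J = nat \<lceil>a * Lk\<rceil> + 1"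
  define c where "c = 2 * ln (16 * real J * real q) + 4 * ln (real k + 1)"
  have Lk: "2 \<le> Lk" unfolding Lk_def using k by (simp add: le_log_iff)
  have Lq: "1 \<le> Lq" unfolding Lq_def using q_ge_2 by simp
  have aLk: "1 * 2 \<le> a * Lk" using assms Lk by (intro mult_mono) auto
  have J_ge: "a * Lk + 1 \<le> real J" unfolding J_def by linarith
  have J1: "1 \<le> real J" unfolding J_def by simp
  have J_le: "real J \<le> 2 * a * Lk" using aLk unfolding J_def by linarith
  have "2 powr (a * Lk) = (2 powr Lk) powr a" by (simp add: powr_powr mult.commute)
  then have "real n \<le> 2 powr (a * Lk)" using n k unfolding Lk_def by simp
  also have "\<dots> < 2 powr (real J)" using J_ge by simp
  finally have "real n < real (2 ^ J)" by (simp add: powr_realpow)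
  then have nJ: "n < 2 ^ J" by (simp only: of_nat_less_iff)
  have c_le: "c \<le> A * (Lk * Lq)"
    unfolding c_def A_def Lk_def Lq_def
    by (rule log_budget) (use assms k q_ge_2 J1 J_le in \<open>auto simp: Lk_def\<close>)
  have A0: "0 \<le> A" unfolding A_def using assms by simp
  have c0: "0 \<le> c"
  proof -
    have "1 * 1 \<le> 16 * real J * real q" using J1 q_ge_2 by (intro mult_mono) auto
    then show ?thesis unfolding c_def by simp
  qed
  \<comment> \<open>As \<open>Lk\<close> \<ge> 2, multiplying by the squared iterated logarithm only
    enlarges the bound.\<close>
  have loglog: "1 \<le> (log 2 Lk)\<^sup>2" using Lk by (simp add: one_le_power)
  have "16 * c * real k * real J \<le> 16 * (A * (Lk * Lq)) * real k * (2 * a * Lk)"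
    using c_le c0 J_le A0 Lk Lq assms by (intro mult_mono) auto
  also have "\<dots> = 32 * a * A * real k * Lk\<^sup>2 * Lq * 1" by (simp add: power2_eq_square)
  also have "\<dots> \<le> 32 * a * A * real k * Lk\<^sup>2 * Lq * (log 2 Lk)\<^sup>2"
    using loglog A0 assms Lq by (intro mult_left_mono) auto
  finally have "16 * c * real k * real J / eps\<^sup>2 \<le> 32 * a * A * real k * Lk\<^sup>2 * Lq * (log 2 Lk)\<^sup>2 / eps\<^sup>2"
    by (intro divide_right_mono) auto
  moreover have "has_sparsifier R n C eps (16 * c * real k * real J / eps\<^sup>2)"
    using sparsifier_of_subspace[OF linear_code_subsp(1)[OF code] _ nJ _ eps, of c]
      linear_code_subsp(2)[OF code] k unfolding c_def J_def by simp
  ultimately show "has_sparsifier R n C eps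
      (32 * a * (2 * log 2 (32 * a) + 12) * real k * (log 2 (real k))\<^sup>2 * log 2 (real (card (carrier R)))
         * (log 2 (log 2 (real k)))\<^sup>2 / eps\<^sup>2)"
    unfolding A_def Lk_def Lq_def by (rule has_sparsifier_mono[rotated])
qed

end
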